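(* Let $F$ be any field. Let $R\colon F[x]\to F[x]$ be an injective Rota--Baxter operator of weight $1$, and put $R'=-R-\mathrm{id}$. If $R'$ is not injective, then $R=-\mathrm{id}$.
   Context: A Rota--Baxter operator of weight $1$ on $F[x]$ is an $F$-linear map $R\colon F[x]\to F[x]$ such that $R(f)R(g)=R\big(R(f)g+fR(g)\big)+R(fg)$ for all $f,g\in F[x]$. *)

theory Defs
  imports "HOL-Computational_Algebra.Polynomial"
begin

definition rota_baxter_weight_one :: "('a::field poly \<Rightarrow> 'a poly) \<Rightarrow> bool" where
  "rota_baxter_weight_one R \<longleftrightarrow>
     Vector_Spaces.linear smult smult R \<and>
     (\<forall>f g. R f * R g = R (R f * g + f * R g) + R (f * g))"

end

theory Submission
  imports Defs
begin

text \<open>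
  Write \<open>S = R + id = - R'\<close>.  The identity for \<open>R\<close> says that \<open>R\<close> sends the product
  \<open>f \<circ> g = R f * g + f * R g + f * g\<close> to the ordinary product, and a direct computation shows
  that \<open>S\<close> does so too.  Therefore \<open>S R\<inverse>\<close> is a homomorphism from the subalgebra \<open>im R\<close> of
  \<open>F[x]\<close> to \<open>F[x]\<close>; its kernel is \<open>ker S\<close>, on which \<open>R = - id\<close>, and this kernel is an ideal
  of \<open>im R\<close>.  By hypothesis it contains some \<open>k \<noteq> 0\<close>.

  If \<open>k\<close> is not constant, then \<open>im R / k (im R)\<close> has dimension at most \<open>degree k\<close>: division by
  \<open>k\<close> within \<open>im R\<close> leaves at most one new degree in each residue class modulo \<open>degree k\<close>.
  Hence the image of \<open>S\<close> has bounded degree (\<open>bounded_degree_of_multiples_killed\<close>).  But it is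
  closed under powers, so it consists of constants.  In particular \<open>R 1 = S 1 - 1\<close> is a constant
  \<open>t\<close>, and \<open>t \<noteq> 0\<close> by injectivity; the identity at \<open>f = g = 1\<close> reads \<open>t\<^sup>2 = (2 t + 1) t\<close>, which
  forces \<open>t = -1\<close>.  If \<open>k\<close> is constant, then \<open>R 1 = -1\<close> by linearity.  Either way \<open>1\<close> lies in
  the ideal \<open>ker S\<close> of \<open>im R\<close>, so \<open>S (R f) = 0\<close> for all \<open>f\<close>, and injectivity of \<open>R\<close> turns
  \<open>R (R f) = R (- f)\<close> into \<open>R f = - f\<close>.
\<close>

text \<open>
  The image of \<open>R\<close> is a module over \<open>F[k]\<close>, generated by one element of least degree for each
  residue class modulo \<open>degree k\<close> that occurs.  The map sending \<open>R f\<close> to \<open>S f\<close> kills every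
  element of \<open>k (im R)\<close>, so its values are linear combinations of those at the finitely many
  generators.  For an injective Rota--Baxter operator \<open>R\<close> this applies to \<open>S = R + id\<close> and
  \<open>k \<in> ker S\<close>.
\<close>

lemma bounded_degree_of_multiples_killed:
  fixes R S :: "'a::field poly \<Rightarrow> 'a poly" and k :: "'a poly"
  assumes linR: "Vector_Spaces.linear smult smult R"
    and linS: "Vector_Spaces.linear smult smult S"
    and ker: "\<And>f. R f = 0 \<Longrightarrow> S f = 0"
    and k: "degree k > 0"
    and mult: "\<And>f. \<exists>g. R g = k * R f \<and> S g = 0"
  shows "\<exists>D. \<forall>f. degree (S f) \<le> D"
proof -
  interpret R: Vector_Spaces.linear smult smult R by fact
  interpret S: Vector_Spaces.linear smult smult S by fact
  let ?d = "degree k"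
  have power_mult: "\<exists>g. R g = k ^ Suc j * R f \<and> S g = 0" for j f
  proof (induction j)
    case 0
    show ?case using mult[of f] by simp
  next
    case (Suc j)
    then obtain g where "R g = k ^ Suc j * R f" by blast
    with mult[of g] show ?case by (auto simp: mult.assoc)
  qed
  define Deg where "Deg = {degree (R f) | f. R f \<noteq> 0}"
  define M where "M = {n \<in> Deg. \<forall>m\<in>Deg. m mod ?d = n mod ?d \<longrightarrow> n \<le> m}"
  have "\<forall>n\<in>Deg. \<exists>f. R f \<noteq> 0 \<and> degree (R f) = n"
    unfolding Deg_def by blast
  then obtain u where u: "\<And>n. n \<in> Deg \<Longrightarrow> R (u n) \<noteq> 0 \<and> degree (R (u n)) = n"
    by metis
  have "finite M"
  proof (rule finite_imageD)
    have "(\<lambda>n. n mod ?d) ` M \<subseteq> {..<?d}" using k by auto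
    then show "finite ((\<lambda>n. n mod ?d) ` M)" using finite_subset by blast
    show "inj_on (\<lambda>n. n mod ?d) M"
      by (rule inj_onI) (simp add: M_def order.antisym)
  qed
  define D where "D = (\<Sum>n\<in>M. degree (S (u n)))"
  have D: "degree (S (u n)) \<le> D" if "n \<in> M" for n
    unfolding D_def using that \<open>finite M\<close> by (intro member_le_sum) auto
  have "degree (S f) \<le> D" for f
  proof (induction "degree (R f)" arbitrary: f rule: less_induct)
    case less
    show ?case
    proof (cases "R f = 0")
      case True
      then show ?thesis using ker by simp
    next
      case False
      let ?n = "degree (R f)"
      have n: "?n \<in> Deg" using False by (auto simp: Deg_def)
      have "\<exists>h. R h \<noteq> 0 \<and> degree (R h) = ?n \<and> degree (S h) \<le> D"
      proof (cases "?n \<in> M")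
        case True
        then show ?thesis using u[OF n] D by blast
      next
        case False
        then obtain m where m: "m \<in> Deg" "m mod ?d = ?n mod ?d" "m < ?n"
          using n unfolding M_def by force
        have "?d dvd ?n - m"
          using m mod_eq_dvd_iff_nat[of m ?n ?d] by simp
        then obtain i where i: "?n - m = ?d * i" by blast
        with m obtain j where j: "i = Suc j" by (cases i) auto
        obtain g where g: "R g = k ^ Suc j * R (u m)" "S g = 0"
          using power_mult by blast
        have "k ^ Suc j \<noteq> 0" using k by auto
        then have "R g \<noteq> 0" "degree (R g) = ?n"
          using u[OF m(1)] g i j m(3)
          by (auto simp del: power_Suc simp: degree_mult_eq degree_power_eq mult.commute)
        then show ?thesis using g(2) by auto
      qed
      then obtain h where h: "R h \<noteq> 0" "degree (R h) = ?n" "degree (S h) \<le> D" by blast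
      define a where "a = lead_coeff (R f) / lead_coeff (R h)"
      define f' where "f' = f - smult a h"
      have Rf': "R f' = R f - smult a (R h)"
        by (simp add: f'_def R.diff R.scale)
      have Sf: "S f = S f' + smult a (S h)"
        by (simp add: f'_def S.diff S.scale)
      have "degree (R f') \<le> ?n"
        unfolding Rf' using h(2) by (intro degree_diff_le) (auto intro: order.trans[OF degree_smult_le])
      moreover have "coeff (R f') ?n = 0"
        unfolding Rf' a_def using h(1,2) leading_coeff_neq_0[OF h(1)] by simp
      ultimately have "R f' = 0 \<or> degree (R f') < ?n"
        by (rule eq_zero_or_degree_less)
      then have "degree (S f') \<le> D"
        using less ker by fastforce
      then show ?thesis
        unfolding Sf using h(3) by (intro degree_add_le) (auto intro: order.trans[OF degree_smult_le])
    qed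
  qed
  then show ?thesis by blast
qed

text \<open>
  Both \<open>R\<close> and \<open>R + id\<close> turn \<open>f \<circ> g\<close> into the ordinary product, so the pairs
  \<open>(R f, R f + f)\<close> form a subalgebra of \<open>F[x] \<times> F[x]\<close>.
\<close>

lemma rota_baxter_product:
  assumes "rota_baxter_weight_one R"
  shows "\<exists>h. R h = R f * R g \<and> R h + h = (R f + f) * (R g + g)"
proof (intro exI conjI)
  interpret R: Vector_Spaces.linear smult smult R
    using assms by (simp add: rota_baxter_weight_one_def)
  let ?h = "R f * g + f * R g + f * g"
  show *: "R ?h = R f * R g"
    using assms unfolding rota_baxter_weight_one_def by (metis R.add)
  show "R ?h + ?h = (R f + f) * (R g + g)"
    unfolding * by (simp add: algebra_simps)
qed

lemma rota_baxter_power: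
  assumes "rota_baxter_weight_one R"
  shows "\<exists>h. R h + h = (R f + f) ^ Suc n"
proof (induction n)
  case 0
  show ?case by auto
next
  case (Suc n)
  then obtain h where "R h + h = (R f + f) ^ Suc n" by blast
  with rota_baxter_product[OF assms, of f h] show ?case by auto
qed

text \<open>The kernel of \<open>R + id\<close> is an ideal of the image of \<open>R\<close>.\<close>

lemma rota_baxter_kernel_ideal:
  assumes "rota_baxter_weight_one R" "R k = - k"
  shows "\<exists>g. R g = k * R f \<and> R g + g = 0"
proof -
  interpret R: Vector_Spaces.linear smult smult R
    using assms by (simp add: rota_baxter_weight_one_def)
  have "R (- k) = k" using assms(2) by (simp add: R.neg)
  with rota_baxter_product[OF assms(1), of "- k" f] show ?thesis by simp
qed

text \<open>If the ideal contains \<open>1\<close>, it is all of \<open>im R\<close>.\<close>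

lemma rota_baxter_eq_neg_id:
  assumes "rota_baxter_weight_one R" "inj R" "R 1 = - 1"
  shows "R f = - f"
proof -
  obtain g where g: "R g = R f" "R g + g = 0"
    using rota_baxter_kernel_ideal[OF assms(1,3), of f] by auto
  then have "g = f" using assms(2) by (simp add: inj_eq)
  then show ?thesis using g(2) by (simp add: eq_neg_iff_add_eq_0)
qed

text \<open>Were some \<open>R f + f\<close> not constant, its powers would have unbounded degree.\<close>

lemma rota_baxter_degree_eq_0:
  assumes RB: "rota_baxter_weight_one R" and "inj R"
    and k: "R k = - k" "degree k > 0"
  shows "degree (R f + f) = 0"
proof (rule ccontr)
  assume nonconst: "degree (R f + f) \<noteq> 0"
  have linR: "Vector_Spaces.linear smult smult R"
    using RB by (simp add: rota_baxter_weight_one_def)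
  interpret R: Vector_Spaces.linear smult smult R by fact
  have linS: "Vector_Spaces.linear smult smult (\<lambda>f. R f + f)"
    by unfold_locales (simp_all add: R.add R.scale smult_add_right)
  have "f = 0" if "R f = 0" for f
    using that \<open>inj R\<close> R.zero by (metis injD)
  then have "\<exists>D. \<forall>f. degree (R f + f) \<le> D"
    using rota_baxter_kernel_ideal[OF RB k(1)]
    by (intro bounded_degree_of_multiples_killed[OF linR linS _ k(2)]) auto
  then obtain D where D: "\<And>f. degree (R f + f) \<le> D" by blast
  obtain h where "R h + h = (R f + f) ^ Suc D"
    using rota_baxter_power[OF RB] by blast
  then have "degree (R h + h) = Suc D * degree (R f + f)"
    using nonconst degree_power_eq[of "R f + f" "Suc D"] by fastforce
  with D[of h] nonconst show False
    by (cases "degree (R f + f)") auto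
qed

theorem proposition3p1:
  fixes R R' :: "'a::field poly \<Rightarrow> 'a poly"
  assumes "rota_baxter_weight_one R"
    and "inj R"
    and "R' = (\<lambda>f. - R f - id f)"
    and "\<not> inj R'"
  shows "R = (\<lambda>f. - id f)"
proof -
  interpret R: Vector_Spaces.linear smult smult R
    using assms(1) by (simp add: rota_baxter_weight_one_def)
  obtain a b where "a \<noteq> b" "- R a - a = - R b - b"
    using assms(3,4) by (auto simp: inj_def)
  then have "R (a - b) = - (a - b)" "a - b \<noteq> 0"
    by (simp_all add: R.diff algebra_simps)
  then obtain k where k: "R k = - k" "k \<noteq> 0" by blast
  have "R 1 = - 1"
  proof (cases "degree k = 0")
    case True
    then obtain c where c: "k = [:c:]" by (rule degree_eq_zeroE)
    then have "smult c (R 1) = smult c (- 1)"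
      using k(1) R.scale[of c 1] by simp
    moreover have "c \<noteq> 0" using k(2) c by simp
    ultimately show ?thesis by (metis smult_cancel)
  next
    case False
    then have "degree (R 1 + 1) = 0"
      using rota_baxter_degree_eq_0[OF assms(1,2) k(1)] by simp
    then obtain s where "R 1 + 1 = [:s:]" by (rule degree_eq_zeroE)
    then have "R 1 = [:s:] - 1" by (simp add: eq_diff_eq)
    then obtain t where t: "R 1 = [:t:]" by (simp add: one_pCons)
    have "R 1 \<noteq> 0"
      using assms(2) R.zero by (metis injD zero_neq_one)
    then have "t \<noteq> 0" using t by simp
    have "R 1 * R 1 = R (R 1 * 1 + 1 * R 1) + R (1 * 1)"
      using assms(1) unfolding rota_baxter_weight_one_def by blast
    also have "R 1 * 1 + 1 * R 1 = smult (t + t) 1"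
      by (simp add: t)
    finally have "[:t * t:] = [:(t + t) * t + t:]"
      by (simp only: R.scale t mult_1) simp
    then have "t * t = (t + t) * t + t" by (simp only: pCons_eq_iff)
    then have "t * (t + 1) = 0" by (simp add: algebra_simps)
    then have "t = - 1" using \<open>t \<noteq> 0\<close> by (simp add: eq_neg_iff_add_eq_0)
    then show ?thesis using t by (simp add: one_pCons)
  qed
  then show ?thesis
    using rota_baxter_eq_neg_id[OF assms(1,2)] by auto
qed

end
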